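(* Let $q$ be an odd prime power. Then for every $n\ge 0$, $$c_{n,0}^{(q)}=1,\qquad c_{n,r}^{(q)}=0\quad\text{if } r>\left\lfloor\frac n2\right\rfloor,$$ and for $1\le r\le\lfloor n/2\rfloor$, $$c_{n,r}^{(q)}=q^r c_{n-1,r}^{(q)}+\Bigl[q^{n-r}-q^{r-1}+\kappa_n(q)\Bigr]c_{n-1,r-1}^{(q)},$$ where $$\kappa_n(q)=\begin{cases}(q-1)\,\chi\bigl((-1)^{n/2}\bigr)\,q^{(n-2)/2},&n\text{ even},\\ 0,&n\text{ odd}.\end{cases}$$ The total number of $n\times n$ upper triangular matrices $U$ over $\mathbb F_q$ with $U^TU=0$ is $$|C_{n,q}|=\sum_{r\ge 0}c_{n,r}^{(q)}.$$
   Context: For a finite field $\mathbb F_q$, $C_{n,q}$ is the set of $n\times n$ upper triangular matrices $U$ over $\mathbb F_q$ with $U^TU=0$, and $c_{n,r}^{(q)}$ is the number of those of rank $r$. Conventions: $c_{0,0}^{(q)}=1$, and all out-of-range values are zero. $\chi$ is the quadratic character of $\mathbb F_q$: $\chi(x)=1$ for nonzero squares, $-1$ for nonsquares, and $\chi(0)=0$. *)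

theory Defs
  imports
    "HOL-Library.Cardinality"
    "HOL-Number_Theory.Prime_Powers"
    "Jordan_Normal_Form.DL_Rank"
begin

text \<open>
  The finite field is a type \<open>'a\<close> of class \<open>{field, finite}\<close>, with \<open>q = CARD('a)\<close>.
  Constants that depend on the field only through its type take an argument \<open>TYPE('a)\<close>.
\<close>

definition isotropic_upper :: "'a :: field itself \<Rightarrow> nat \<Rightarrow> 'a mat set" where
  "isotropic_upper _ n =
     {U \<in> carrier_mat n n. upper_triangular U \<and> transpose_mat U * U = 0\<^sub>m n n}"

definition rank_count :: "'a :: field itself \<Rightarrow> nat \<Rightarrow> nat \<Rightarrow> nat" where
  "rank_count F n r = card {U \<in> isotropic_upper F n. vec_space.rank n U = r}"

definition quadratic_character :: "'a :: field \<Rightarrow> int" where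
  "quadratic_character x = (if x = 0 then 0 else if \<exists>y. x = y ^ 2 then 1 else -1)"

text \<open>
  For \<open>n = 0\<close> the exponent below is truncated; the recurrence only involves
  \<open>kappa\<close> for \<open>n \<ge> 2\<close>.
\<close>

definition kappa :: "'a :: {field, finite} itself \<Rightarrow> nat \<Rightarrow> int" where
  "kappa _ n =
     (if even n
      then (int CARD('a) - 1) * quadratic_character ((-1 :: 'a) ^ (n div 2))
             * int CARD('a) ^ ((n - 2) div 2)
      else 0)"

end

theory Submission
  imports Defs "HOL-Number_Theory.Residues" "Berlekamp_Zassenhaus.Berlekamp_Type_Based"
begin

text \<open>
  A matrix of size \<open>m + 1\<close> in the set is a matrix \<open>U\<close> of size \<open>m\<close> in the set,
  bordered by a last column \<open>(v, a)\<close> that is isotropic, \<open>v \<bullet> v + a\<^sup>2 = 0\<close>, and orthogonal to all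
  earlier columns, \<open>U\<^sup>T v = 0\<close> (\<open>isotropic_upper_Suc\<close>).  So the recurrence follows once it is known,
  for a fixed \<open>U\<close> of rank \<open>s\<close>, how many such columns there are and how many of them leave the
  rank unchanged.

  The rank stays \<open>s\<close> exactly when the new column lies in the column space of \<open>U\<close>, that is, when
  \<open>a = 0\<close> and \<open>v\<close> is one of the \<open>q\<^sup>s\<close> vectors in the image of \<open>U\<close>; each of these is admissible,
  because the column space is totally isotropic.  Otherwise the rank becomes \<open>s + 1\<close>.

  The number of all admissible columns is \<open>q\<close> to the power \<open>m - s\<close>, plus \<open>kappa (m + 1)\<close>
  (\<open>card_extensions\<close>).  The idea that replaces Witt's theorem is a translation argument.  Let \<open>W\<close> be
  the image of \<open>U\<close>.  Along a coset \<open>v + W\<close> the form satisfies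
  \<open>(v + w) \<bullet> (v + w) = v \<bullet> v + 2 (v \<bullet> w)\<close>.  If \<open>v\<close> is not orthogonal to \<open>W\<close>, this is a
  nonconstant affine function of \<open>w\<close> (here \<open>q\<close> odd enters), so it takes the value \<open>d\<close> on exactly
  one \<open>q\<close>-th of the coset.  Hence vectors outside the orthogonal complement of \<open>W\<close> contribute as
  if the form were equidistributed, and the count inside the complement follows from the count on the
  whole space and the size \<open>q\<^sup>m / q\<^sup>s\<close> of the complement
  (\<open>card_left_kernel_quadric\<close>).

  The count on the whole space is the number of zeros of a sum of \<open>n\<close> squares
  (\<open>card_quadric_0\<close>).  It is found by removing two coordinates at a time: the number of solutions of
  \<open>x\<^sup>2 + y\<^sup>2 = c\<close> is \<open>q - \<chi>(-1)\<close> for every \<open>c \<noteq> 0\<close>, since multiplication of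
  "Gaussian integers" over the field permutes the fibres over nonzero values transitively.

  The same isotropy shows that the image of \<open>U\<close> is contained in its orthogonal complement, so
  \<open>s \<le> n - s\<close>, which is the vanishing statement.  Ranks are handled throughout by cardinalities:
  the image of a matrix of rank \<open>s\<close> has \<open>q\<^sup>s\<close> elements.
\<close>

section \<open>Cardinalities of images and kernels\<close>

text \<open>
  Each vector has a unique coordinate function with respect to a finite basis.
\<close>

lemma (in vectorspace) card_carrier_eq_power_dim:
  assumes "fin_dim"
  shows "card (carrier V) = card (carrier K) ^ dim"
proof -
  obtain B where B: "finite B" "basis B"
    using finite_basis_exists[OF assms] by blast
  have "B \<subseteq> carrier V" using B(2) by (simp add: basis_def)
  then have *: "\<forall>v. v \<in> carrier V \<longrightarrow> (\<exists>!a. a \<in> B \<rightarrow>\<^sub>E carrier K \<and> lincomb a B = v)"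
    using basis_criterion[OF B(1)] B(2) by blast
  have "bij_betw (\<lambda>a. lincomb a B) (B \<rightarrow>\<^sub>E carrier K) (carrier V)"
    unfolding bij_betw_def inj_on_def
  proof (intro conjI ballI impI)
    have closed: "lincomb a B \<in> carrier V" if "a \<in> B \<rightarrow>\<^sub>E carrier K" for a
      using that \<open>B \<subseteq> carrier V\<close> by (intro lincomb_closed) auto
    show "a = b" if "a \<in> B \<rightarrow>\<^sub>E carrier K" "b \<in> B \<rightarrow>\<^sub>E carrier K" "lincomb a B = lincomb b B" for a b
      using * closed that by metis
    show "(\<lambda>a. lincomb a B) ` (B \<rightarrow>\<^sub>E carrier K) = carrier V"
      using * closed by (auto simp: image_iff)
  qed
  then have "card (carrier V) = card (B \<rightarrow>\<^sub>E carrier K)"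
    by (simp add: bij_betw_same_card)
  also have "\<dots> = card (carrier K) ^ card B"
    using B(1) by (rule card_funcsetE)
  finally show ?thesis using dim_basis[OF B] by simp
qed

definition mat_image :: "'a :: field mat \<Rightarrow> 'a vec set" where
  "mat_image A = (\<lambda>y. A *\<^sub>v y) ` carrier_vec (dim_col A)"

text \<open>
  The orthogonal complement of the column space with respect to the dot product.
\<close>

definition left_kernel :: "'a :: field mat \<Rightarrow> 'a vec set" where
  "left_kernel A = {v \<in> carrier_vec (dim_row A). A\<^sup>T *\<^sub>v v = 0\<^sub>v (dim_col A)}"

lemma mat_image_closed:
  assumes A: "A \<in> carrier_mat nr nc"
  shows "mat_image A \<subseteq> carrier_vec nr"
  unfolding mat_image_def
  by (rule image_subsetI, rule mult_mat_vec_carrier[OF A]) (simp add: carrier_matD(2)[OF A])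

text \<open>
  The image is the column space, whose dimension is the rank.  Below, ranks are compared only through
  this cardinality.
\<close>

lemma card_mat_image_eq_power_rank:
  fixes A :: "'a :: {field, finite} mat"
  assumes A: "A \<in> carrier_mat n nc"
  shows "card (mat_image A) = CARD('a) ^ vec_space.rank n A"
proof -
  interpret vec_space "TYPE('a)" n .
  have cols: "set (cols A) \<subseteq> carrier V"
    using A cols_dim[of A] by auto
  have "mat_image A = span (set (cols A))"
    using col_space_eq[OF A] A unfolding col_space_def mat_image_def by auto
  moreover have "vectorspace class_ring (vs (span (set (cols A))))"
    using A cols_dim[of A] by (auto intro!: subspace_is_vs span_is_subspace)
  moreover have "vectorspace.fin_dim class_ring (vs (span (set (cols A))))"
    using A cols_dim[of A] by (intro fin_dim_span) auto
  ultimately show ?thesis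
    using vectorspace.card_carrier_eq_power_dim[of class_ring "vs (span (set (cols A)))"]
    by (simp add: rank_def class_ring_simps(1))
qed

text \<open>
  Multiplying by \<open>CARD('a)\<close> avoids the exponent \<open>m - 1\<close>.  All fibres of a nonzero functional
  have the same size, because translating by a multiple of a unit vector on which \<open>w\<close> does not vanish
  carries any fibre to any other.
\<close>

lemma card_hyperplane:
  fixes w :: "'a :: {field, finite} vec"
  assumes w: "w \<in> carrier_vec m"
  shows "CARD('a) * card {y \<in> carrier_vec m. w \<bullet> y = c} =
    (if w \<noteq> 0\<^sub>v m then CARD('a) ^ m else if c = 0 then CARD('a) ^ Suc m else 0)"
proof (cases "w = 0\<^sub>v m")
  case True
  then have "{y \<in> carrier_vec m. w \<bullet> y = c} = (if c = 0 then carrier_vec m else {})"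
    by auto
  then show ?thesis using True by (simp add: card_carrier_vec)
next
  case False
  then obtain j where j: "j < m" "w $ j \<noteq> 0"
    using w by (metis carrier_vecD eq_vecI index_zero_vec(1) index_zero_vec(2))
  let ?F = "\<lambda>c. {y \<in> carrier_vec m. w \<bullet> y = c}"
  have "card (?F d) = card (?F c)" for d
  proof -
    let ?e = "\<lambda>t. (t / w $ j) \<cdot>\<^sub>v unit_vec m j"
    have e: "?e t \<in> carrier_vec m" "w \<bullet> ?e t = t" for t
      using w j by auto
    have "bij_betw (\<lambda>y. y + ?e (c - d)) (?F d) (?F c)"
      by (rule bij_betwI[where g = "\<lambda>y. y - ?e (c - d)"])
        (auto simp: scalar_prod_add_distrib[OF w] scalar_prod_minus_distrib[OF w] w e(2))
    then show ?thesis by (rule bij_betw_same_card)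
  qed
  then have "(\<Sum>d\<in>UNIV. card (?F d)) = (\<Sum>d\<in>(UNIV :: 'a set). card (?F c))"
    by (rule sum.cong[OF refl])
  moreover have "card (carrier_vec m :: 'a vec set) = (\<Sum>d\<in>UNIV. card (?F d))"
    using sum.group[of "carrier_vec m" UNIV "\<lambda>y. w \<bullet> y" "\<lambda>_. 1::nat"]
    by simp
  ultimately show ?thesis using False by (simp add: card_carrier_vec)
qed

lemma card_kernel_times_card_image:
  fixes A :: "'a :: {field, finite} mat"
  assumes A: "A \<in> carrier_mat nr nc"
  shows "card {y \<in> carrier_vec nc. A *\<^sub>v y = 0\<^sub>v nr} * card (mat_image A) = CARD('a) ^ nc"
proof -
  let ?K = "{y \<in> carrier_vec nc. A *\<^sub>v y = 0\<^sub>v nr}"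
  have image: "mat_image A = (\<lambda>y. A *\<^sub>v y) ` carrier_vec nc"
    using A by (simp add: mat_image_def)
  have fibre: "card {y \<in> carrier_vec nc. A *\<^sub>v y = z} = card ?K" if z: "z \<in> mat_image A" for z
  proof -
    obtain x where x: "x \<in> carrier_vec nc" "z = A *\<^sub>v x"
      using z unfolding image by blast
    have "bij_betw (\<lambda>y. y - x) {y \<in> carrier_vec nc. A *\<^sub>v y = z} ?K"
      using x A by (intro bij_betwI[where g = "\<lambda>y. y + x"])
        (auto simp: mult_minus_distrib_mat_vec[OF A] mult_add_distrib_mat_vec[OF A])
    then show ?thesis by (rule bij_betw_same_card)
  qed
  have "card (carrier_vec nc :: 'a vec set)
      = (\<Sum>z\<in>mat_image A. card {y \<in> carrier_vec nc. A *\<^sub>v y = z})"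
    using sum.group[of "carrier_vec nc" "mat_image A" "\<lambda>y. A *\<^sub>v y" "\<lambda>_. 1::nat"]
    by (simp add: image)
  then show ?thesis by (simp add: fibre card_carrier_vec mult.commute)
qed

lemma card_field_gt_1: "1 < CARD('a :: {field, finite})"
  using card_mono[of UNIV "{0, 1 :: 'a}"] by simp

lemma sum_const_plus_indicator:
  fixes c d :: nat
  assumes "finite X" and "K \<subseteq> X"
  shows "(\<Sum>x\<in>X. c + (if x \<in> K then d else 0)) = card X * c + card K * d"
  using assms by (simp add: sum.distrib sum.If_cases Int_absorb1)

text \<open>
  The pairs \<open>(v, y)\<close> with \<open>v \<bullet> (A y) = 0\<close> can be counted by fixing \<open>v\<close> or by fixing \<open>y\<close>; by
  the hyperplane count each total depends only on the size of the kernel on that side.  This compares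
  the two kernels, and so gives the size of the left kernel without equality of row and
  column rank.
\<close>

lemma card_left_kernel_times_card_image:
  fixes A :: "'a :: {field, finite} mat"
  assumes A: "A \<in> carrier_mat nr nc"
  shows "card (left_kernel A) * card (mat_image A) = CARD('a) ^ nr"
proof -
  let ?q = "CARD('a)" and ?X = "carrier_vec nr :: 'a vec set" and ?Y = "carrier_vec nc :: 'a vec set"
  let ?K = "{y \<in> ?Y. A *\<^sub>v y = 0\<^sub>v nr}"
  have fin: "finite ?X" "finite ?Y" by auto
  have q: "?q > 0" by simp
  have swap: "(\<Sum>v\<in>?X. card {y \<in> ?Y. v \<bullet> (A *\<^sub>v y) = 0})
      = (\<Sum>y\<in>?Y. card {v \<in> ?X. v \<bullet> (A *\<^sub>v y) = 0})"
    using sum.swap_restrict[OF fin, of "\<lambda>_ _. 1::nat" "\<lambda>v y. v \<bullet> (A *\<^sub>v y) = 0"] by simp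
  have l: "?q * card {y \<in> ?Y. v \<bullet> (A *\<^sub>v y) = 0}
      = ?q ^ nc + (if v \<in> left_kernel A then ?q ^ nc * (?q - 1) else 0)" if "v \<in> ?X" for v
  proof -
    have "{y \<in> ?Y. v \<bullet> (A *\<^sub>v y) = 0} = {y \<in> ?Y. (A\<^sup>T *\<^sub>v v) \<bullet> y = 0}"
      using that A by (auto simp: transpose_vec_mult_scalar)
    then show ?thesis
      using card_hyperplane[of "A\<^sup>T *\<^sub>v v" nc 0] that A q
      by (auto simp: left_kernel_def algebra_simps)
  qed
  have r: "?q * card {v \<in> ?X. v \<bullet> (A *\<^sub>v y) = 0}
      = ?q ^ nr + (if y \<in> ?K then ?q ^ nr * (?q - 1) else 0)" if "y \<in> ?Y" for y
  proof -
    have "{v \<in> ?X. v \<bullet> (A *\<^sub>v y) = 0} = {v \<in> ?X. (A *\<^sub>v y) \<bullet> v = 0}"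
      using that A comm_scalar_prod[of _ nr "A *\<^sub>v y"] by auto
    then show ?thesis
      using card_hyperplane[of "A *\<^sub>v y" nr 0] that A q
      by (auto simp: algebra_simps)
  qed
  have sub: "left_kernel A \<subseteq> ?X" "?K \<subseteq> ?Y" using A by (auto simp: left_kernel_def)
  have "?q * (\<Sum>v\<in>?X. card {y \<in> ?Y. v \<bullet> (A *\<^sub>v y) = 0})
      = (\<Sum>v\<in>?X. ?q ^ nc + (if v \<in> left_kernel A then ?q ^ nc * (?q - 1) else 0))"
    by (simp add: sum_distrib_left l)
  also have "\<dots> = ?q ^ nr * ?q ^ nc + card (left_kernel A) * (?q ^ nc * (?q - 1))"
    by (simp only: sum_const_plus_indicator[OF fin(1) sub(1)] card_carrier_vec)
  finally have L: "?q * (\<Sum>v\<in>?X. card {y \<in> ?Y. v \<bullet> (A *\<^sub>v y) = 0})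
      = ?q ^ nr * ?q ^ nc + card (left_kernel A) * (?q ^ nc * (?q - 1))" .
  have "?q * (\<Sum>y\<in>?Y. card {v \<in> ?X. v \<bullet> (A *\<^sub>v y) = 0})
      = (\<Sum>y\<in>?Y. ?q ^ nr + (if y \<in> ?K then ?q ^ nr * (?q - 1) else 0))"
    unfolding sum_distrib_left by (rule sum.cong[OF refl], rule r)
  also have "\<dots> = ?q ^ nc * ?q ^ nr + card ?K * (?q ^ nr * (?q - 1))"
    by (simp only: sum_const_plus_indicator[OF fin(2) sub(2)] card_carrier_vec)
  finally have R: "?q * (\<Sum>y\<in>?Y. card {v \<in> ?X. v \<bullet> (A *\<^sub>v y) = 0})
      = ?q ^ nc * ?q ^ nr + card ?K * (?q ^ nr * (?q - 1))" .
  have "(?q - 1) * (card (left_kernel A) * ?q ^ nc) = (?q - 1) * (card ?K * ?q ^ nr)"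
    using L R unfolding swap by (auto simp: ac_simps)
  moreover have "1 < ?q"
    by (rule card_field_gt_1)
  ultimately have eq: "card (left_kernel A) * ?q ^ nc = card ?K * ?q ^ nr" by simp
  have "?q ^ nc * (card (left_kernel A) * card (mat_image A))
      = (card (left_kernel A) * ?q ^ nc) * card (mat_image A)" by simp
  also have "\<dots> = ?q ^ nr * (card ?K * card (mat_image A))" unfolding eq by simp
  also have "\<dots> = ?q ^ nc * ?q ^ nr"
    unfolding card_kernel_times_card_image[OF A] by simp
  finally show ?thesis by simp
qed

section \<open>Sums of two squares over a finite field\<close>

text \<open>
  The characteristic divides the number of elements.
\<close>

lemma two_neq_0_if_odd_card:
  assumes "odd CARD('a :: {field, finite})"
  shows "(2 :: 'a) \<noteq> 0"
proof
  assume "(2 :: 'a) = 0"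
  then have "CHAR('a) dvd 2" by (metis of_nat_eq_0_iff_char_dvd of_nat_numeral)
  moreover have "CHAR('a) \<noteq> 1" by simp
  ultimately have "CHAR('a) = 2"
    using two_is_prime_nat by (metis prime_nat_iff)
  then show False using CHAR_dvd_CARD[where 'a='a] assms by simp
qed

definition two_squares :: "'a :: field \<Rightarrow> ('a \<times> 'a) set" where
  "two_squares c = {(x, y). x * x + y * y = c}"

text \<open>
  Pigeonhole: more than half of all elements are squares, because every element is one of the two
  square roots of its square.  Hence the set \<open>S\<close> of squares meets \<open>c - S\<close>.
\<close>

lemma sum_of_two_squares_finite_field:
  fixes c :: "'a :: {field, finite}"
  assumes odd: "odd CARD('a)"
  shows "two_squares c \<noteq> {}"
proof -
  define S where "S = range (\<lambda>x :: 'a. x * x)"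
  define g where "g = (\<lambda>s :: 'a. SOME x. x * x = s)"
  have g: "g (x * x) * g (x * x) = x * x" for x
    unfolding g_def by (rule someI[of _ x]) simp
  \<comment> \<open>\<open>g\<close> chooses a square root of each square, so every element is \<open>g s\<close> or \<open>- g s\<close>.\<close>
  have "UNIV = g ` S \<union> (\<lambda>s. - g s) ` S"
  proof (intro equalityI subsetI UnCI)
    fix x :: 'a
    assume "x \<notin> (\<lambda>s. - g s) ` S"
    then have "x \<noteq> - g (x * x)" by (auto simp: S_def)
    moreover have "(x - g (x * x)) * (x + g (x * x)) = 0"
      using g[of x] by (simp add: algebra_simps)
    ultimately have "x = g (x * x)" by (simp add: eq_neg_iff_add_eq_0)
    then show "x \<in> g ` S" by (auto simp: S_def)
  qed auto
  then have "CARD('a) \<le> card (g ` S) + card ((\<lambda>s. - g s) ` S)"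
    by (metis card_Un_le)
  also have "\<dots> \<le> card S + card S"
    by (intro add_mono card_image_le) auto
  finally have half: "CARD('a) < card S + card S"
    using odd by (metis dvd_triv_left le_neq_implies_less mult_2)
  have "card ((\<lambda>s. c - s) ` S) = card S" by (intro card_image) (auto simp: inj_on_def)
  then have "S \<inter> (\<lambda>s. c - s) ` S \<noteq> {}"
    using half card_Un_disjoint[of S "(\<lambda>s. c - s) ` S"] card_mono[of UNIV "S \<union> (\<lambda>s. c - s) ` S"]
    by auto
  then obtain s where "s \<in> S" "c - s \<in> S" by auto
  then show ?thesis by (auto simp: two_squares_def S_def) (metis add.commute diff_add_cancel)
qed

text \<open>
  If \<open>-1 = i\<^sup>2\<close>, the form splits as \<open>(x - i y) (x + i y)\<close> and its zeros are two lines through the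
  origin; otherwise the origin is its only zero.
\<close>

lemma card_two_squares_0:
  assumes "odd CARD('a :: {field, finite})"
  shows "int (card (two_squares (0 :: 'a)))
    = 1 + (int CARD('a) - 1) * (1 + quadratic_character (-1 :: 'a))"
proof (cases "\<exists>i :: 'a. -1 = i\<^sup>2")
  case True
  then obtain i :: 'a where i: "i * i = -1" by (auto simp: power2_eq_square)
  then have "i \<noteq> 0" by auto
  have "2 * i \<noteq> 0" using \<open>i \<noteq> 0\<close> two_neq_0_if_odd_card[OF assms] by simp
  then have "i \<noteq> - i" by (simp add: eq_neg_iff_add_eq_0 flip: mult_2)
  have sq: "x * x + y * y = (x - i * y) * (x + i * y)" for x y
  proof -
    have "(x - i * y) * (x + i * y) = x * x - (i * i) * (y * y)" by (simp add: algebra_simps)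
    then show ?thesis by (simp add: i)
  qed
  let ?L = "\<lambda>i. (\<lambda>y. (i * y, y)) ` (UNIV - {0 :: 'a})"
  have "two_squares (0 :: 'a) = insert (0, 0) (?L i \<union> ?L (- i))"
    unfolding two_squares_def sq by (auto simp: eq_neg_iff_add_eq_0) 
  moreover have "card (?L i \<union> ?L (- i)) = card (?L i) + card (?L (- i))"
    using \<open>i \<noteq> - i\<close> by (intro card_Un_disjoint) (auto simp: eq_neg_iff_add_eq_0)
  moreover have "card (?L j) = CARD('a) - 1" for j
    by (subst card_image) (auto simp: inj_on_def card_Diff_singleton)
  moreover have "card (insert (0, 0) (?L i \<union> ?L (- i))) = Suc (card (?L i \<union> ?L (- i)))"
    by (rule card_insert_disjoint) auto
  ultimately have "card (two_squares (0 :: 'a)) = Suc ((CARD('a) - 1) + (CARD('a) - 1))"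
    by (simp only:)
  moreover have "quadratic_character (-1 :: 'a) = 1"
    using True by (simp add: quadratic_character_def)
  moreover have "1 < CARD('a)" by (rule card_field_gt_1)
  ultimately show ?thesis by (simp add: of_nat_diff)
next
  case False
  have "x = 0 \<and> y = 0" if "x * x + y * y = 0" for x y :: 'a
  proof -
    have "y = 0"
    proof (rule ccontr)
      assume "y \<noteq> 0"
      have "x * x = - (y * y)" using that by (simp add: eq_neg_iff_add_eq_0)
      then have "(x / y)\<^sup>2 = -1" using \<open>y \<noteq> 0\<close> by (simp add: power2_eq_square field_simps)
      then show False using False by metis
    qed
    then show ?thesis using that by simp
  qed
  then have "x * x + y * y = 0 \<longleftrightarrow> x = 0 \<and> y = 0" for x y :: 'a
    by (metis add_0 mult_zero_left)
  then have "two_squares (0 :: 'a) = {(0, 0)}" by (auto simp: two_squares_def)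
  then show ?thesis using False by (simp add: quadratic_character_def)
qed

text \<open>
  Write \<open>c = a\<^sup>2 + b\<^sup>2\<close>.  Multiplication by the formal number \<open>a + b i\<close> multiplies the norm
  \<open>x\<^sup>2 + y\<^sup>2\<close> by \<open>c\<close>, and it is inverted by multiplication with \<open>(a - b i) / c\<close>.
\<close>

lemma card_two_squares_eq:
  fixes c :: "'a :: {field, finite}"
  assumes "odd CARD('a)" and "c \<noteq> 0"
  shows "card (two_squares c) = card (two_squares (1 :: 'a))"
proof -
  obtain a b where ab: "a * a + b * b = c"
    using sum_of_two_squares_finite_field[OF assms(1), of c] by (auto simp: two_squares_def)
  let ?f = "\<lambda>(x, y). (a * x - b * y, a * y + b * x)"
  let ?g = "\<lambda>(x, y). ((a * x + b * y) / c, (a * y - b * x) / c)"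
  have f: "(a * x - b * y) * (a * x - b * y) + (a * y + b * x) * (a * y + b * x) = c * (x * x + y * y)"
    and g: "(a * x + b * y) * (a * x + b * y) + (a * y - b * x) * (a * y - b * x) = c * (x * x + y * y)"
    and fg: "a * (a * x - b * y) + b * (a * y + b * x) = c * x"
      "a * (a * y + b * x) - b * (a * x - b * y) = c * y"
    and gf: "a * (a * x + b * y) - b * (a * y - b * x) = c * x"
      "a * (a * y - b * x) + b * (a * x + b * y) = c * y" for x y
    unfolding ab[symmetric] by (simp_all add: algebra_simps)
  have "bij_betw ?f (two_squares 1) (two_squares c)"
  proof (rule bij_betwI[where g = ?g])
    show "?f \<in> two_squares 1 \<rightarrow> two_squares c" by (auto simp: two_squares_def f)
    show "?g \<in> two_squares c \<rightarrow> two_squares 1"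
      using assms(2) by (auto simp: two_squares_def g simp flip: add_divide_distrib)
    show "?g (?f p) = p" for p
      using assms(2) by (cases p) (simp add: fg)
    show "?f (?g p) = p" for p
      using assms(2) by (cases p) (simp add: gf flip: diff_divide_distrib add_divide_distrib)
  qed
  then show ?thesis by (simp add: bij_betw_same_card)
qed

text \<open>
  All fibres over nonzero values have the same size, the fibre over zero is known, and together the
  fibres exhaust the \<open>q\<^sup>2\<close> pairs.
\<close>

lemma card_two_squares:
  fixes c :: "'a :: {field, finite}"
  assumes odd: "odd CARD('a)" and "c \<noteq> 0"
  shows "int (card (two_squares c)) = int CARD('a) - quadratic_character (-1 :: 'a)"
proof -
  let ?q = "CARD('a)" and ?\<chi> = "quadratic_character (-1 :: 'a)"
  have "?q * ?q = card (UNIV :: ('a \<times> 'a) set)"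
    by (simp flip: UNIV_Times_UNIV)
  also have "\<dots> = (\<Sum>d\<in>UNIV. card (two_squares (d :: 'a)))"
    using sum.group[of "UNIV :: ('a \<times> 'a) set" UNIV "\<lambda>(x, y). x * x + y * y" "\<lambda>_. 1::nat"]
    by (simp add: two_squares_def case_prod_unfold)
  also have "\<dots> = card (two_squares (0 :: 'a)) + (\<Sum>d\<in>UNIV - {0}. card (two_squares (d :: 'a)))"
    by (simp add: sum.remove)
  also have "(\<Sum>d\<in>UNIV - {0}. card (two_squares (d :: 'a))) = (?q - 1) * card (two_squares c)"
  proof -
    have "card (two_squares d) = card (two_squares c)" if "d \<in> UNIV - {0}" for d :: 'a
      using that card_two_squares_eq[OF odd, of d] card_two_squares_eq[OF odd, of c] assms(2)
      by (metis DiffE singletonI)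
    then have "(\<Sum>d\<in>UNIV - {0}. card (two_squares (d :: 'a)))
        = (\<Sum>d\<in>UNIV - {0 :: 'a}. card (two_squares c))"
      by (rule sum.cong[OF refl])
    then show ?thesis by (simp add: card_Diff_singleton)
  qed
  finally have "?q * ?q = card (two_squares (0 :: 'a)) + (?q - 1) * card (two_squares c)" .
  then have "int (?q * ?q) = int (card (two_squares (0 :: 'a)) + (?q - 1) * card (two_squares c))"
    by (rule arg_cong)
  then have "int ?q * int ?q = int (card (two_squares (0 :: 'a))) + (int ?q - 1) * int (card (two_squares c))"
    using card_field_gt_1[where 'a='a] by (simp add: of_nat_diff)
  then have "(int ?q - 1) * int (card (two_squares c)) = (int ?q - 1) * (int ?q - ?\<chi>)"
    unfolding card_two_squares_0[OF odd] by (simp add: algebra_simps)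
  then show ?thesis using card_field_gt_1[where 'a='a] by simp
qed

section \<open>Zeros of a sum of squares\<close>

definition quadric :: "nat \<Rightarrow> 'a :: field \<Rightarrow> 'a vec set" where
  "quadric n c = {x \<in> carrier_vec n. x \<bullet> x = c}"

lemma finite_quadric [simp]: "finite (quadric n (c :: 'a :: {field, finite}))"
  by (simp add: quadric_def)

lemma carrier_vec_SucE:
  assumes "w \<in> carrier_vec (Suc n)"
  obtains a x where "w = vCons a x" and "x \<in> carrier_vec n"
  using assms by (cases w) auto

text \<open>
  Prepending coordinates \<open>a\<close>, \<open>b\<close> to \<open>x\<close> gives a zero exactly when \<open>a\<^sup>2 + b\<^sup>2 = - x \<bullet> x\<close>.  The
  number of such pairs is \<open>q - \<chi>\<close>, with an excess of \<open>q \<chi>\<close> when \<open>x\<close> is itself a zero.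
\<close>

lemma card_quadric_step:
  fixes q \<chi> :: int
  assumes odd: "odd CARD('a :: {field, finite})"
  defines "q \<equiv> int CARD('a)" and "\<chi> \<equiv> quadratic_character (-1 :: 'a)"
  shows "int (card (quadric (Suc (Suc n)) (0 :: 'a)))
    = q ^ n * (q - \<chi>) + q * \<chi> * int (card (quadric n (0 :: 'a)))"
proof -
  let ?X = "carrier_vec n :: 'a vec set"
  let ?P = "SIGMA x:?X. two_squares (- (x \<bullet> x))"
  have "bij_betw (\<lambda>(x, a, b). vCons a (vCons b x)) ?P (quadric (Suc (Suc n)) 0)"
    unfolding bij_betw_def
  proof
    show "inj_on (\<lambda>(x, a, b). vCons a (vCons b x)) ?P" by (auto simp: inj_on_def)
    show "(\<lambda>(x, a, b). vCons a (vCons b x)) ` ?P = quadric (Suc (Suc n)) 0"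
    proof (intro equalityI subsetI)
      fix w :: "'a vec"
      assume w: "w \<in> quadric (Suc (Suc n)) 0"
      then obtain a b x where "w = vCons a (vCons b x)" "x \<in> ?X"
        unfolding quadric_def by (metis (no_types, lifting) mem_Collect_eq carrier_vec_SucE)
      moreover from this have "(a, b) \<in> two_squares (- (x \<bullet> x))"
        using w by (simp add: quadric_def two_squares_def eq_neg_iff_add_eq_0 add.assoc)
      ultimately show "w \<in> (\<lambda>(x, a, b). vCons a (vCons b x)) ` ?P" by force
    qed (auto simp: quadric_def two_squares_def eq_neg_iff_add_eq_0 add.assoc)
  qed
  then have "card (quadric (Suc (Suc n)) (0 :: 'a)) = (\<Sum>x\<in>?X. card (two_squares (- (x \<bullet> x))))"
    by (simp add: flip: bij_betw_same_card)
  moreover have "int (card (two_squares (- (x \<bullet> x))))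
      = (q - \<chi>) + (if x \<in> quadric n 0 then q * \<chi> else 0)" if "x \<in> ?X" for x
    using that card_two_squares[OF odd, of "- (x \<bullet> x)"] card_two_squares_0[OF odd]
    by (auto simp: quadric_def q_def \<chi>_def algebra_simps)
  ultimately have "int (card (quadric (Suc (Suc n)) (0 :: 'a)))
      = (\<Sum>x\<in>?X. (q - \<chi>) + (if x \<in> quadric n 0 then q * \<chi> else 0))" by simp
  also have "\<dots> = int (card ?X) * (q - \<chi>) + int (card (?X \<inter> quadric n 0)) * (q * \<chi>)"
    by (simp add: sum.distrib sum.If_cases)
  also have "?X \<inter> quadric n 0 = quadric n 0" by (auto simp: quadric_def)
  finally show ?thesis by (simp add: card_carrier_vec q_def)
qed

lemma quadratic_character_minus_one_power:
  fixes k
  defines "\<chi> \<equiv> quadratic_character (-1 :: 'a :: field)"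
  shows "quadratic_character ((-1 :: 'a) ^ k) = \<chi> ^ k"
proof -
  have "quadratic_character (1 :: 'a) = 1"
    by (auto simp: quadratic_character_def intro: exI[of _ 1])
  moreover have "\<chi> = 1 \<or> \<chi> = -1" by (auto simp: \<chi>_def quadratic_character_def)
  ultimately show ?thesis by (cases "even k") (auto simp: \<chi>_def)
qed

text \<open>
  Dimension 2 is treated apart, starting from dimension 0: the formula for the count fails
  at \<open>n = 0\<close>, where the exponent in \<open>kappa\<close> is truncated.
\<close>

lemma card_quadric_0:
  assumes odd: "odd CARD('a :: {field, finite})" and "n > 0"
  shows "int (card (quadric n (0 :: 'a))) = int CARD('a) ^ (n - 1) + kappa TYPE('a) n"
  using assms(2)
proof (induction n rule: induct_nat_012)
  case 1
  have "quadric 1 (0 :: 'a) = {0\<^sub>v 1}"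
    by (auto simp: quadric_def scalar_prod_def)
  then show ?case by (simp add: kappa_def)
next
  case (ge2 n)
  let ?q = "int CARD('a)" and ?\<chi> = "quadratic_character (-1 :: 'a)"
  note step = card_quadric_step[OF odd, of n]
  show ?case
  proof (cases "n = 0")
    case True
    have "quadric 0 (0 :: 'a) = {0\<^sub>v 0}" by (auto simp: quadric_def scalar_prod_def)
    then show ?thesis using step True by (simp add: kappa_def algebra_simps)
  next
    case False
    have kappa: "kappa TYPE('a) (Suc (Suc n)) = ?q * ?\<chi> * kappa TYPE('a) n"
    proof (cases "even n")
      case True
      then obtain k where "n = 2 * Suc k" using False by (metis evenE mult_0_right not0_implies_Suc)
      then show ?thesis unfolding kappa_def quadratic_character_minus_one_power by simp
    qed (simp add: kappa_def)
    have "?q * ?q ^ (n - 1) = ?q ^ n" using False by (simp flip: power_Suc)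
    then show ?thesis
      using ge2.IH(1) False unfolding step kappa
      by (simp add: algebra_simps)
  qed
qed simp

section \<open>Isotropic vectors orthogonal to a totally isotropic image\<close>

text \<open>
  The pairs \<open>(v, y)\<close> for which \<open>v + U y\<close> lies on the quadric are counted in two ways.
  For fixed \<open>y\<close> this is a translate of the quadric.  For fixed \<open>v\<close>
  the condition is affine in \<open>y\<close> with gradient \<open>2 U\<^sup>T v\<close>, since \<open>U y\<close> is isotropic: it holds for all
  or no \<open>y\<close> if \<open>v\<close> is in the left kernel, and on a hyperplane otherwise.
\<close>

lemma card_left_kernel_quadric:
  fixes U :: "'a :: {field, finite} mat"
  assumes odd: "odd CARD('a)"
    and U: "U \<in> carrier_mat m k" and iso: "U\<^sup>T * U = 0\<^sub>m k k"
  shows "CARD('a) * card (quadric m d) + card (left_kernel U)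
    = CARD('a) * card (left_kernel U \<inter> quadric m d) + CARD('a) ^ m"
proof -
  let ?q = "CARD('a)" and ?X = "carrier_vec m :: 'a vec set" and ?Y = "carrier_vec k :: 'a vec set"
  \<comment> \<open>The quadratic term in \<open>y\<close> vanishes because \<open>U\<^sup>T U = 0\<close>.\<close>
  have norm: "(v + U *\<^sub>v y) \<bullet> (v + U *\<^sub>v y) = v \<bullet> v + (2 \<cdot>\<^sub>v (U\<^sup>T *\<^sub>v v)) \<bullet> y"
    if v: "v \<in> ?X" and y: "y \<in> ?Y" for v y
  proof -
    have Uy: "U *\<^sub>v y \<in> ?X" using U y by simp
    have "(U *\<^sub>v y) \<bullet> (U *\<^sub>v y) = (U\<^sup>T *\<^sub>v (U *\<^sub>v y)) \<bullet> y"
      using transpose_vec_mult_scalar[OF U y Uy] by simp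
    also have "U\<^sup>T *\<^sub>v (U *\<^sub>v y) = (U\<^sup>T * U) *\<^sub>v y"
      using U y by (simp add: assoc_mult_mat_vec[of _ k m])
    also have "\<dots> = 0\<^sub>v k" unfolding iso using y by auto
    finally have "(U *\<^sub>v y) \<bullet> (U *\<^sub>v y) = 0" using y by simp
    moreover have "v \<bullet> (U *\<^sub>v y) = (U\<^sup>T *\<^sub>v v) \<bullet> y"
      using transpose_vec_mult_scalar[OF U y v] by simp
    ultimately show ?thesis
      using v y U Uy comm_scalar_prod[OF v Uy]
      by (simp add: scalar_prod_add_distrib[of _ m] add_scalar_prod_distrib[of _ m])
  qed
  have translate: "card {v \<in> ?X. (v + U *\<^sub>v y) \<bullet> (v + U *\<^sub>v y) = d} = card (quadric m d)"
    if y: "y \<in> ?Y" for y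
  proof -
    let ?z = "U *\<^sub>v y"
    have z: "?z \<in> ?X" using U y by simp
    have cancel: "v + z - z = v" "v - z + z = v" if "v \<in> ?X" "z \<in> ?X" for v z
      using that by auto
    have "bij_betw (\<lambda>v. v + ?z) {v \<in> ?X. (v + ?z) \<bullet> (v + ?z) = d} (quadric m d)"
    proof (rule bij_betwI[where g = "\<lambda>v. v - ?z"])
      show "(v + ?z) - ?z = v" if "v \<in> {v \<in> ?X. (v + ?z) \<bullet> (v + ?z) = d}" for v
        using that cancel[OF _ z] by simp
      have *: "(v - ?z) + ?z = v" if "v \<in> ?X" for v
        using cancel[OF that z] by simp
      show "(v - ?z) + ?z = v" if "v \<in> quadric m d" for v
        using that * by (simp add: quadric_def)
      show "(\<lambda>v. v - ?z) \<in> quadric m d \<rightarrow> {v \<in> ?X. (v + ?z) \<bullet> (v + ?z) = d}"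
        using z * by (simp add: quadric_def Pi_iff)
    qed (use z in \<open>simp add: quadric_def Pi_iff\<close>)
    then show ?thesis by (rule bij_betw_same_card)
  qed
  have fibre: "?q * card {y \<in> ?Y. (v + U *\<^sub>v y) \<bullet> (v + U *\<^sub>v y) = d} + (if v \<in> left_kernel U then ?q ^ k else 0)
      = ?q ^ k + (if v \<in> left_kernel U \<inter> quadric m d then ?q ^ Suc k else 0)"
    if v: "v \<in> ?X" for v
  proof -
    let ?w = "2 \<cdot>\<^sub>v (U\<^sup>T *\<^sub>v v)"
    have w: "?w \<in> ?Y" using U v by simp
    have w0: "?w = 0\<^sub>v k \<longleftrightarrow> v \<in> left_kernel U"
      using U v two_neq_0_if_odd_card[OF odd] by (auto simp: left_kernel_def vec_eq_iff)
    have "{y \<in> ?Y. (v + U *\<^sub>v y) \<bullet> (v + U *\<^sub>v y) = d} = {y \<in> ?Y. ?w \<bullet> y = d - v \<bullet> v}"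
      using norm[OF v] by (auto simp: algebra_simps)
    then show ?thesis
      using card_hyperplane[OF w, of "d - v \<bullet> v"] v unfolding w0
      by (auto simp: quadric_def)
  qed
  have swap: "(\<Sum>v\<in>?X. card {y \<in> ?Y. (v + U *\<^sub>v y) \<bullet> (v + U *\<^sub>v y) = d})
      = (\<Sum>y\<in>?Y. card {v \<in> ?X. (v + U *\<^sub>v y) \<bullet> (v + U *\<^sub>v y) = d})"
    using sum.swap_restrict[of ?X ?Y "\<lambda>_ _. 1::nat" "\<lambda>v y. (v + U *\<^sub>v y) \<bullet> (v + U *\<^sub>v y) = d"]
    by simp
  have sub: "left_kernel U \<subseteq> ?X" using U by (auto simp: left_kernel_def)
  have indicator: "(\<Sum>v\<in>?X. if v \<in> K then c else 0) = card K * c" if "K \<subseteq> ?X" for K and c :: nat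
    using sum_const_plus_indicator[OF _ that, of 0 c] by simp
  have "?q ^ k * (?q * card (quadric m d) + card (left_kernel U))
      = ?q * (\<Sum>y\<in>?Y. card {v \<in> ?X. (v + U *\<^sub>v y) \<bullet> (v + U *\<^sub>v y) = d})
        + (\<Sum>v\<in>?X. if v \<in> left_kernel U then ?q ^ k else 0)"
    by (simp add: translate indicator[OF sub] card_carrier_vec algebra_simps)
  also have "\<dots> = (\<Sum>v\<in>?X. ?q * card {y \<in> ?Y. (v + U *\<^sub>v y) \<bullet> (v + U *\<^sub>v y) = d}
        + (if v \<in> left_kernel U then ?q ^ k else 0))"
    by (simp only: sum_distrib_left sum.distrib flip: swap)
  also have "\<dots> = (\<Sum>v\<in>?X. ?q ^ k + (if v \<in> left_kernel U \<inter> quadric m d then ?q ^ Suc k else 0))"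
    by (rule sum.cong[OF refl]) (rule fibre)
  also have "\<dots> = card ?X * ?q ^ k + card (left_kernel U \<inter> quadric m d) * ?q ^ Suc k"
    by (rule sum_const_plus_indicator) (use sub in auto)
  also have "\<dots> = ?q ^ k * (?q * card (left_kernel U \<inter> quadric m d) + ?q ^ m)"
    by (simp add: card_carrier_vec algebra_simps)
  finally show ?thesis by simp
qed

text \<open>
  The columns \<open>(v, a)\<close> that may border \<open>U\<close> when \<open>U\<^sup>T U = 0\<close>; \<open>a\<close> is the new diagonal entry.
\<close>

definition extensions :: "'a :: field mat \<Rightarrow> ('a vec \<times> 'a) set" where
  "extensions U = {(v, a). v \<in> left_kernel U \<and> v \<bullet> v + a * a = 0}"

lemma finite_left_kernel [simp]: "finite (left_kernel (U :: 'a :: {field, finite} mat))"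
  by (simp add: left_kernel_def)

lemma finite_extensions [simp]: "finite (extensions (U :: 'a :: {field, finite} mat))"
  by (rule finite_subset[of _ "left_kernel U \<times> UNIV"]) (auto simp: extensions_def)

lemma card_quadric_Suc:
  "card (quadric (Suc m) (0 :: 'a :: {field, finite})) = (\<Sum>a\<in>UNIV. card (quadric m (- (a * a :: 'a))))"
proof -
  let ?P = "SIGMA a:UNIV. quadric m (- (a * a :: 'a))"
  have "bij_betw (\<lambda>(a, x). vCons a x) ?P (quadric (Suc m) 0)"
    unfolding bij_betw_def
  proof
    show "inj_on (\<lambda>(a, x). vCons a x) ?P" by (auto simp: inj_on_def)
    show "(\<lambda>(a, x). vCons a x) ` ?P = quadric (Suc m) 0"
    proof (intro equalityI subsetI)
      fix w :: "'a vec"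
      assume w: "w \<in> quadric (Suc m) 0"
      then have "w \<in> carrier_vec (Suc m)" by (simp add: quadric_def)
      then obtain a x where "w = vCons a x" "x \<in> carrier_vec m" by (rule carrier_vec_SucE)
      with w show "w \<in> (\<lambda>(a, x). vCons a x) ` ?P"
        by (force simp: quadric_def eq_neg_iff_add_eq_0 add.commute)
    qed (auto simp: quadric_def)
  qed
  then show ?thesis by (simp flip: bij_betw_same_card)
qed

text \<open>
  For each \<open>a\<close>, the vectors \<open>v\<close> form the part of the quadric of level \<open>- a\<^sup>2\<close> inside the left
  kernel.  Summed over \<open>a\<close>, these levels assemble the zeros of a sum of \<open>m + 1\<close> squares.
\<close>

lemma card_extensions:
  fixes U :: "'a :: {field, finite} mat"
  assumes odd: "odd CARD('a)"
    and U: "U \<in> carrier_mat m k" and iso: "U\<^sup>T * U = 0\<^sub>m k k"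
  shows "int (card (extensions U)) = int (card (left_kernel U)) + kappa TYPE('a) (Suc m)"
proof -
  let ?q = "CARD('a)"
  let ?E = "\<lambda>a. left_kernel U \<inter> quadric m (- (a * a))"
  have "bij_betw prod.swap (SIGMA a:UNIV. ?E a) (extensions U)"
    using U by (intro bij_betwI[where g = prod.swap])
      (auto simp: extensions_def quadric_def left_kernel_def eq_neg_iff_add_eq_0)
  then have E: "card (extensions U) = (\<Sum>a\<in>UNIV. card (?E a))"
    by (simp flip: bij_betw_same_card)
  have "?q * (card (quadric (Suc m) (0 :: 'a)) + card (left_kernel U))
      = (\<Sum>a\<in>(UNIV :: 'a set). ?q * card (quadric m (- (a * a))) + card (left_kernel U))"
    by (simp add: sum.distrib sum_distrib_left card_quadric_Suc algebra_simps)
  also have "\<dots> = (\<Sum>a\<in>UNIV. ?q * card (?E a) + ?q ^ m)"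
    by (simp only: card_left_kernel_quadric[OF odd U iso])
  also have "\<dots> = ?q * (card (extensions U) + ?q ^ m)"
    by (simp add: sum.distrib sum_distrib_left E algebra_simps)
  finally have "card (quadric (Suc m) (0 :: 'a)) + card (left_kernel U) = card (extensions U) + ?q ^ m"
    by simp
  then have "int (card (quadric (Suc m) (0 :: 'a))) + int (card (left_kernel U))
      = int (card (extensions U)) + int ?q ^ m"
    by (metis of_nat_add of_nat_power)
  then show ?thesis using card_quadric_0[OF odd, of "Suc m"] by simp
qed

section \<open>Bordering a matrix by a column\<close>

definition snoc_vec :: "'a vec \<Rightarrow> 'a \<Rightarrow> 'a vec" where
  "snoc_vec v a = vec (Suc (dim_vec v)) (\<lambda>i. if i < dim_vec v then v $ i else a)"

definition border :: "nat \<Rightarrow> 'a :: field mat \<Rightarrow> 'a vec \<Rightarrow> 'a \<Rightarrow> 'a mat" where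
  "border m U v a = mat (Suc m) (Suc m)
     (\<lambda>(i, j). if j < m then if i < m then U $$ (i, j) else 0 else snoc_vec v a $ i)"

lemma snoc_vec_eq_iff [simp]: "snoc_vec v a = snoc_vec w b \<longleftrightarrow> v = w \<and> a = b"
proof
  assume eq: "snoc_vec v a = snoc_vec w b"
  then have dim: "dim_vec v = dim_vec w" unfolding snoc_vec_def by (metis dim_vec nat.inject)
  have "v $ i = w $ i" if "i < dim_vec v" for i
    using that dim arg_cong[OF eq, of "\<lambda>x. x $ i"] by (simp add: snoc_vec_def)
  moreover have "a = b"
    using dim arg_cong[OF eq, of "\<lambda>x. x $ dim_vec v"] by (simp add: snoc_vec_def)
  ultimately show "v = w \<and> a = b" using dim by auto
qed simp

lemma carrier_vec_SucE_snoc: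
  assumes "w \<in> carrier_vec (Suc m)"
  obtains v a where "w = snoc_vec v a" and "v \<in> carrier_vec m"
proof
  show "w = snoc_vec (vec m (\<lambda>i. w $ i)) (w $ m)"
    using assms by (intro eq_vecI) (auto simp: snoc_vec_def less_Suc_eq)
qed simp

lemma border_carrier [simp]: "border m U v a \<in> carrier_mat (Suc m) (Suc m)"
  by (simp add: border_def)

lemma border_eq_iff:
  assumes "U \<in> carrier_mat m m" "v \<in> carrier_vec m" "U' \<in> carrier_mat m m" "v' \<in> carrier_vec m"
  shows "border m U v a = border m U' v' a' \<longleftrightarrow> U = U' \<and> v = v' \<and> a = a'"
proof
  assume eq: "border m U v a = border m U' v' a'"
  have "U = U'"
  proof (rule eq_matI)
    fix i j assume "i < dim_row U'" "j < dim_col U'"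
    then show "U $$ (i, j) = U' $$ (i, j)"
      using assms arg_cong[OF eq, of "\<lambda>M. M $$ (i, j)"] by (simp add: border_def)
  qed (use assms in auto)
  moreover have "snoc_vec v a = snoc_vec v' a'"
  proof (rule eq_vecI)
    fix i assume "i < dim_vec (snoc_vec v' a')"
    then show "snoc_vec v a $ i = snoc_vec v' a' $ i"
      using assms arg_cong[OF eq, of "\<lambda>M. M $$ (i, m)"] by (simp add: border_def snoc_vec_def)
  qed (use assms in \<open>simp add: snoc_vec_def\<close>)
  ultimately show "U = U' \<and> v = v' \<and> a = a'" by simp
qed simp

text \<open>
  The entries of the Gram matrix outside \<open>U\<^sup>T U\<close> are those of \<open>U\<^sup>T v\<close>, twice, and the corner
  \<open>v \<bullet> v + a\<^sup>2\<close>.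
\<close>

lemma border_gram_zero_iff:
  fixes U :: "'a :: field mat"
  assumes U: "U \<in> carrier_mat m m" and v: "v \<in> carrier_vec m"
  shows "(border m U v a)\<^sup>T * border m U v a = 0\<^sub>m (Suc m) (Suc m)
    \<longleftrightarrow> U\<^sup>T * U = 0\<^sub>m m m \<and> (v, a) \<in> extensions U"
proof -
  let ?B = "border m U v a"
  have entry: "(?B\<^sup>T * ?B) $$ (i, j) =
      (if i < m then if j < m then (U\<^sup>T * U) $$ (i, j) else (U\<^sup>T *\<^sub>v v) $ i
       else if j < m then (U\<^sup>T *\<^sub>v v) $ j else v \<bullet> v + a * a)"
    if "i < Suc m" "j < Suc m" for i j
    using that U v
    by (auto simp: scalar_prod_def border_def snoc_vec_def atLeast0LessThan less_Suc_eq mult.commute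
        intro!: sum.cong)
  have "?B\<^sup>T * ?B = 0\<^sub>m (Suc m) (Suc m) \<longleftrightarrow> (\<forall>i<Suc m. \<forall>j<Suc m. (?B\<^sup>T * ?B) $$ (i, j) = 0)"
    by (auto simp: border_def mat_eq_iff)
  also have "\<dots> \<longleftrightarrow> (\<forall>i<m. \<forall>j<m. (U\<^sup>T * U) $$ (i, j) = 0) \<and> (\<forall>i<m. (U\<^sup>T *\<^sub>v v) $ i = 0)
      \<and> v \<bullet> v + a * a = 0"
    by (simp add: entry All_less_Suc del: index_mult_mat index_mult_mat_vec) blast
  also have "(\<forall>i<m. \<forall>j<m. (U\<^sup>T * U) $$ (i, j) = 0) \<longleftrightarrow> U\<^sup>T * U = 0\<^sub>m m m"
    using U by (auto simp: mat_eq_iff)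
  also have "(\<forall>i<m. (U\<^sup>T *\<^sub>v v) $ i = 0) \<longleftrightarrow> v \<in> left_kernel U"
    using U v by (auto simp: left_kernel_def vec_eq_iff)
  finally show ?thesis by (simp add: extensions_def)
qed

lemma border_upper_triangular_iff:
  assumes "U \<in> carrier_mat m m"
  shows "upper_triangular (border m U v a) \<longleftrightarrow> upper_triangular U"
  using assms by (fastforce simp: border_def upper_triangular_def less_Suc_eq)

lemma isotropic_upper_Suc:
  "isotropic_upper TYPE('a :: field) (Suc m)
    = (\<lambda>(U, v, a). border m U v a) ` (SIGMA U:isotropic_upper TYPE('a) m. extensions U)"
proof (intro equalityI subsetI)
  fix M :: "'a mat"
  assume M: "M \<in> isotropic_upper TYPE('a) (Suc m)"
  define U where "U = mat m m (\<lambda>ij. M $$ ij)"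
  define v where "v = vec m (\<lambda>i. M $$ (i, m))"
  have car: "U \<in> carrier_mat m m" "v \<in> carrier_vec m" by (simp_all add: U_def v_def)
  have "M = border m U v (M $$ (m, m))"
    using M by (intro eq_matI)
      (auto simp: isotropic_upper_def border_def snoc_vec_def U_def v_def less_Suc_eq)
  then obtain a where Ma: "M = border m U v a" by blast
  then have "(U, v, a) \<in> (SIGMA U:isotropic_upper TYPE('a) m. extensions U)"
    using M car by (simp add: isotropic_upper_def border_gram_zero_iff border_upper_triangular_iff)
  then show "M \<in> (\<lambda>(U, v, a). border m U v a) ` (SIGMA U:isotropic_upper TYPE('a) m. extensions U)"
    unfolding Ma by force
next
  fix M :: "'a mat"
  assume "M \<in> (\<lambda>(U, v, a). border m U v a) ` (SIGMA U:isotropic_upper TYPE('a) m. extensions U)"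
  then obtain U v a where "M = border m U v a" "U \<in> isotropic_upper TYPE('a) m" "(v, a) \<in> extensions U"
    by auto
  moreover from this have "v \<in> carrier_vec m"
    by (auto simp: extensions_def left_kernel_def isotropic_upper_def)
  ultimately show "M \<in> isotropic_upper TYPE('a) (Suc m)"
    by (simp add: isotropic_upper_def border_gram_zero_iff border_upper_triangular_iff)
qed

lemma border_mult_snoc_vec:
  fixes U :: "'a :: field mat"
  assumes U: "U \<in> carrier_mat m m" and v: "v \<in> carrier_vec m" and y: "y \<in> carrier_vec m"
  shows "border m U v a *\<^sub>v snoc_vec y t = snoc_vec (U *\<^sub>v y + t \<cdot>\<^sub>v v) (a * t)"
  using assms
  by (intro eq_vecI) (auto simp: scalar_prod_def border_def snoc_vec_def atLeast0LessThan less_Suc_eq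
      mult.commute intro!: sum.cong)

lemma mat_image_border:
  fixes U :: "'a :: field mat"
  assumes U: "U \<in> carrier_mat m m" and v: "v \<in> carrier_vec m"
  shows "mat_image (border m U v a) = (\<lambda>(z, t). snoc_vec (z + t \<cdot>\<^sub>v v) (a * t)) ` (mat_image U \<times> UNIV)"
proof -
  have "(carrier_vec (Suc m) :: 'a vec set) = (\<lambda>(y, t). snoc_vec y t) ` (carrier_vec m \<times> UNIV)"
  proof (intro equalityI subsetI)
    fix w :: "'a vec" assume "w \<in> carrier_vec (Suc m)"
    then obtain y t where "w = snoc_vec y t" "y \<in> carrier_vec m" by (rule carrier_vec_SucE_snoc)
    then show "w \<in> (\<lambda>(y, t). snoc_vec y t) ` (carrier_vec m \<times> UNIV)" by auto
  qed (auto simp: snoc_vec_def)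
  then have "mat_image (border m U v a)
      = (\<lambda>(y, t). border m U v a *\<^sub>v snoc_vec y t) ` (carrier_vec m \<times> UNIV)"
    by (simp add: mat_image_def image_image case_prod_unfold border_def)
  also have "\<dots> = (\<lambda>(y, t). snoc_vec (U *\<^sub>v y + t \<cdot>\<^sub>v v) (a * t)) ` (carrier_vec m \<times> UNIV)"
    by (rule image_cong[OF refl]) (auto simp: border_mult_snoc_vec[OF U v])
  also have "\<dots> = (\<lambda>(z, t). snoc_vec (z + t \<cdot>\<^sub>v v) (a * t)) ` (\<lambda>(y, t). (U *\<^sub>v y, t)) ` (carrier_vec m \<times> UNIV)"
    by (simp add: image_image case_prod_unfold)
  also have "(\<lambda>(y, t). (U *\<^sub>v y, t)) ` (carrier_vec m \<times> UNIV) = mat_image U \<times> (UNIV :: 'a set)"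
    using U by (auto simp: mat_image_def)
  finally show ?thesis .
qed

section \<open>The rank of a bordered matrix\<close>

text \<open>
  The image of the bordered matrix consists of the vectors \<open>(z + t v, a t)\<close> with \<open>z\<close> in the image of
  \<open>U\<close>.  The pair \<open>(z, t)\<close> is determined by this vector unless \<open>a = 0\<close> and \<open>v\<close> is itself in the image
  of \<open>U\<close>, in which case \<open>t\<close> contributes nothing new.
\<close>

lemma card_mat_image_border:
  fixes U :: "'a :: {field, finite} mat"
  assumes U: "U \<in> carrier_mat m m" and v: "v \<in> carrier_vec m"
  shows "card (mat_image (border m U v a))
    = (if v \<in> mat_image U \<and> a = 0 then 1 else CARD('a)) * card (mat_image U)"
proof -
  let ?J = "mat_image U" and ?f = "\<lambda>(z, t). snoc_vec (z + t \<cdot>\<^sub>v v) (a * t)"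
  have image: "?J = (\<lambda>y. U *\<^sub>v y) ` carrier_vec m" using U by (simp add: mat_image_def)
  have carrier: "?J \<subseteq> carrier_vec m" by (rule mat_image_closed[OF U])
  have add: "z + z' \<in> ?J" and diff: "z - z' \<in> ?J" and smult: "t \<cdot>\<^sub>v z \<in> ?J"
    if "z \<in> ?J" "z' \<in> ?J" for z z' t
  proof -
    obtain y y' where y: "y \<in> carrier_vec m" "z = U *\<^sub>v y" "y' \<in> carrier_vec m" "z' = U *\<^sub>v y'"
      using \<open>z \<in> ?J\<close> \<open>z' \<in> ?J\<close> unfolding image by blast
    have "z + z' = U *\<^sub>v (y + y')" "z - z' = U *\<^sub>v (y - y')" "t \<cdot>\<^sub>v z = U *\<^sub>v (t \<cdot>\<^sub>v y)"
      using y by (simp_all add: mult_add_distrib_mat_vec[OF U] mult_minus_distrib_mat_vec[OF U]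
          mult_mat_vec[OF U])
    then show "z + z' \<in> ?J" "z - z' \<in> ?J" "t \<cdot>\<^sub>v z \<in> ?J"
      unfolding image using y by auto
  qed
  show ?thesis
  proof (cases "v \<in> ?J \<and> a = 0")
    case True
    have "?f ` (?J \<times> UNIV) = (\<lambda>z. snoc_vec z 0) ` ?J"
    proof (intro equalityI subsetI)
      fix w assume "w \<in> ?f ` (?J \<times> UNIV)"
      then show "w \<in> (\<lambda>z. snoc_vec z 0) ` ?J" using True add smult by auto
    next
      fix w assume "w \<in> (\<lambda>z. snoc_vec z 0) ` ?J"
      then obtain z where "z \<in> ?J" "w = snoc_vec z 0" by blast
      moreover have "z \<in> carrier_vec m" using \<open>z \<in> ?J\<close> carrier by blast
      then have "z + 0 \<cdot>\<^sub>v v = z" using v by (intro eq_vecI) auto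
      ultimately show "w \<in> ?f ` (?J \<times> UNIV)"
        using True by (intro image_eqI[of _ _ "(z, 0)"]) auto
    qed
    moreover have "card ((\<lambda>z. snoc_vec z (0 :: 'a)) ` ?J) = card ?J"
      by (rule card_image) (simp add: inj_on_def)
    ultimately show ?thesis using True mat_image_border[OF U v] by simp
  next
    case False
    have "inj_on ?f (?J \<times> UNIV)"
    proof (rule inj_onI, clarify)
      fix z t z' t'
      assume z: "z \<in> ?J" and z': "z' \<in> ?J"
        and "snoc_vec (z + t \<cdot>\<^sub>v v) (a * t) = snoc_vec (z' + t' \<cdot>\<^sub>v v) (a * t')"
      then have eq: "z + t \<cdot>\<^sub>v v = z' + t' \<cdot>\<^sub>v v" and at: "a * t = a * t'" by auto
      have zc: "z \<in> carrier_vec m" "z' \<in> carrier_vec m" using z z' carrier by auto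
      have entry: "z $ i + t * v $ i = z' $ i + t' * v $ i" if "i < m" for i
        using arg_cong[OF eq, of "\<lambda>x. x $ i"] that zc v by simp
      have "t = t'"
      proof (rule ccontr)
        assume "t \<noteq> t'"
        then have "a = 0" using at by simp
        \<comment> \<open>Two parameters with the same value put \<open>v\<close> into the image of \<open>U\<close>.\<close>
        have "v = (1 / (t - t')) \<cdot>\<^sub>v (z' - z)"
        proof (rule eq_vecI)
          fix i assume "i < dim_vec ((1 / (t - t')) \<cdot>\<^sub>v (z' - z))"
          then show "v $ i = ((1 / (t - t')) \<cdot>\<^sub>v (z' - z)) $ i"
            using entry[of i] zc v \<open>t \<noteq> t'\<close> by (simp add: field_simps)
        qed (use zc v in auto)
        then have "v \<in> ?J" using smult[OF diff[OF z' z] z] by metis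
        then show False using False \<open>a = 0\<close> by simp
      qed
      moreover have "z = z'"
        using entry \<open>t = t'\<close> zc by (intro eq_vecI) auto
      ultimately show "z = z' \<and> t = t'" by simp
    qed
    then show ?thesis
      unfolding if_not_P[OF False] mat_image_border[OF U v]
      by (simp add: card_image card_cartesian_product)
  qed
qed

lemma rank_border:
  fixes U :: "'a :: {field, finite} mat"
  assumes U: "U \<in> carrier_mat m m" and v: "v \<in> carrier_vec m"
  shows "vec_space.rank (Suc m) (border m U v a)
    = (if v \<in> mat_image U \<and> a = 0 then vec_space.rank m U else Suc (vec_space.rank m U))"
proof -
  let ?R = "if v \<in> mat_image U \<and> a = 0 then vec_space.rank m U else Suc (vec_space.rank m U)"
  have "CARD('a) ^ vec_space.rank (Suc m) (border m U v a) = CARD('a) ^ ?R"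
    using card_mat_image_border[OF U v, of a] card_mat_image_eq_power_rank[OF U]
      card_mat_image_eq_power_rank[OF border_carrier, of m U v a]
    by (simp split: if_splits)
  then show ?thesis
    using card_field_gt_1[where 'a='a] power_inject_exp by blast
qed

lemma mat_image_isotropic:
  fixes U :: "'a :: field mat"
  assumes U: "U \<in> carrier_mat m k" and iso: "U\<^sup>T * U = 0\<^sub>m k k"
    and v: "v \<in> mat_image U"
  shows "v \<in> left_kernel U" and "v \<bullet> v = 0"
proof -
  have "mat_image U = (\<lambda>y. U *\<^sub>v y) ` carrier_vec k" using U by (simp add: mat_image_def)
  then obtain y where y: "y \<in> carrier_vec k" "v = U *\<^sub>v y" using v by blast
  have vm: "v \<in> carrier_vec m" using U y by simp
  have "U\<^sup>T *\<^sub>v v = (U\<^sup>T * U) *\<^sub>v y"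
    using U y by (simp add: assoc_mult_mat_vec[of _ k m])
  also have "\<dots> = 0\<^sub>v k" unfolding iso using y by auto
  finally have 0: "U\<^sup>T *\<^sub>v v = 0\<^sub>v k" .
  then show "v \<in> left_kernel U" using vm U by (simp add: left_kernel_def)
  have "v \<bullet> v = (U\<^sup>T *\<^sub>v v) \<bullet> y"
    using transpose_vec_mult_scalar[OF U y(1) vm] y(2) by simp
  then show "v \<bullet> v = 0" unfolding 0 using y by simp
qed

lemma card_left_kernel_rank:
  fixes U :: "'a :: {field, finite} mat"
  assumes U: "U \<in> carrier_mat m k"
  shows "vec_space.rank m U \<le> m"
    and "card (left_kernel U) = CARD('a) ^ (m - vec_space.rank m U)"
proof -
  let ?q = "CARD('a)" and ?s = "vec_space.rank m U"
  have prod: "card (left_kernel U) * ?q ^ ?s = ?q ^ m"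
    using card_left_kernel_times_card_image[OF U] by (simp add: card_mat_image_eq_power_rank[OF U])
  then have "?q ^ ?s dvd ?q ^ m" by (metis dvd_triv_right)
  then show le: "?s \<le> m" using card_field_gt_1[where 'a='a] by (rule power_dvd_imp_le)
  then have "?q ^ m = ?q ^ (m - ?s) * ?q ^ ?s" by (simp flip: power_add)
  then show "card (left_kernel U) = ?q ^ (m - ?s)" using prod by simp
qed

text \<open>
  A totally isotropic image lies in its orthogonal complement, and their dimensions add up
  to \<open>m\<close>.
\<close>

lemma rank_isotropic_le:
  fixes U :: "'a :: {field, finite} mat"
  assumes U: "U \<in> carrier_mat m k" and iso: "U\<^sup>T * U = 0\<^sub>m k k"
  shows "vec_space.rank m U \<le> m div 2"
proof -
  let ?q = "CARD('a)" and ?s = "vec_space.rank m U"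
  have "card (mat_image U) \<le> card (left_kernel U)"
    using mat_image_isotropic(1)[OF U iso] by (intro card_mono) auto
  then have "?q ^ ?s \<le> ?q ^ (m - ?s)"
    by (simp add: card_mat_image_eq_power_rank[OF U] card_left_kernel_rank(2)[OF U])
  then have "?s \<le> m - ?s"
    using card_field_gt_1[where 'a='a] power_le_imp_le_exp by blast
  then show ?thesis using card_left_kernel_rank(1)[OF U] by linarith
qed

section \<open>The recurrence\<close>

lemma finite_isotropic_upper [simp]: "finite (isotropic_upper TYPE('a :: {field, finite}) n)"
proof (induction n)
  case 0
  have "isotropic_upper TYPE('a) 0 \<subseteq> {0\<^sub>m 0 0}" by (auto simp: isotropic_upper_def)
  then show ?case by (rule finite_subset) simp
next
  case (Suc m)
  then show ?case unfolding isotropic_upper_Suc by (intro finite_imageI finite_SigmaI) auto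
qed

text \<open>
  The columns that keep the rank are those of the image of \<open>U\<close>, extended by \<open>a = 0\<close>; all others
  raise it by one.
\<close>

lemma card_extensions_of_rank_Suc:
  fixes U :: "'a :: {field, finite} mat"
  assumes odd: "odd CARD('a)" and U: "U \<in> isotropic_upper TYPE('a) m"
  defines "q \<equiv> int CARD('a)"
  shows "int (card {(v, a) \<in> extensions U. vec_space.rank (Suc m) (border m U v a) = Suc r})
    = (if vec_space.rank m U = Suc r then q ^ Suc r else 0)
      + (if vec_space.rank m U = r then q ^ (m - r) - q ^ r + kappa TYPE('a) (Suc m) else 0)"
proof -
  have car: "U \<in> carrier_mat m m" and iso: "U\<^sup>T * U = 0\<^sub>m m m"
    using U by (auto simp: isotropic_upper_def)
  let ?s = "vec_space.rank m U" and ?I = "mat_image U \<times> {0 :: 'a}" and ?E = "extensions U"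
  have carE: "v \<in> carrier_vec m" if "(v, a) \<in> ?E" for v a
    using that car by (auto simp: extensions_def left_kernel_def)
  have sub: "?I \<subseteq> ?E"
    using mat_image_isotropic[OF car iso] by (auto simp: extensions_def)
  have rank: "vec_space.rank (Suc m) (border m U v a) = (if (v, a) \<in> ?I then ?s else Suc ?s)"
    if "(v, a) \<in> ?E" for v a
    using rank_border[OF car carE[OF that]] by simp
  have I: "int (card ?I) = q ^ ?s"
    using card_mat_image_eq_power_rank[OF car] by (simp add: card_cartesian_product q_def)
  have "int (card (?E - ?I)) = int (card ?E) - int (card ?I)"
    using sub by (simp add: card_Diff_subset finite_subset[OF sub] card_mono of_nat_diff)
  also have "\<dots> = q ^ (m - ?s) - q ^ ?s + kappa TYPE('a) (Suc m)"
    using card_extensions[OF odd car iso] card_left_kernel_rank(2)[OF car] I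
    by (simp add: q_def)
  finally have D: "int (card (?E - ?I)) = q ^ (m - ?s) - q ^ ?s + kappa TYPE('a) (Suc m)" .
  have "{(v, a) \<in> ?E. vec_space.rank (Suc m) (border m U v a) = Suc r}
      = (if ?s = Suc r then ?I else if ?s = r then ?E - ?I else {})"
    using sub rank by (auto split: if_splits)
  then show ?thesis using I D by auto
qed

text \<open>
  The two summands come from the matrices whose rank is kept and from those whose rank is raised by
  the border.
\<close>

lemma rank_count_Suc_Suc:
  assumes odd: "odd CARD('a :: {field, finite})"
  defines "q \<equiv> int CARD('a)"
  shows "int (rank_count TYPE('a) (Suc m) (Suc r))
    = q ^ Suc r * int (rank_count TYPE('a) m (Suc r))
      + (q ^ (m - r) - q ^ r + kappa TYPE('a) (Suc m)) * int (rank_count TYPE('a) m r)"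
proof -
  let ?I = "isotropic_upper TYPE('a) m"
  let ?F = "\<lambda>U. {(v, a) \<in> extensions U. vec_space.rank (Suc m) (border m U v a) = Suc r}"
  have car: "U \<in> carrier_mat m m" "v \<in> carrier_vec m"
    if "U \<in> ?I" "(v, a) \<in> extensions U" for U v a
    using that by (auto simp: isotropic_upper_def extensions_def left_kernel_def)
  have "{M \<in> isotropic_upper TYPE('a) (Suc m). vec_space.rank (Suc m) M = Suc r}
      = (\<lambda>(U, v, a). border m U v a) ` (SIGMA U:?I. ?F U)"
    unfolding isotropic_upper_Suc by force
  moreover have "inj_on (\<lambda>(U, v, a). border m U v a) (SIGMA U:?I. ?F U)"
  proof (rule inj_onI)
    fix x y
    assume "x \<in> (SIGMA U:?I. ?F U)" "y \<in> (SIGMA U:?I. ?F U)"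
      and eq: "(\<lambda>(U, v, a). border m U v a) x = (\<lambda>(U, v, a). border m U v a) y"
    moreover obtain U v a U' v' a' where xy: "x = (U, v, a)" "y = (U', v', a')"
      by (metis prod_cases3)
    ultimately have "U \<in> ?I" "(v, a) \<in> extensions U" "U' \<in> ?I" "(v', a') \<in> extensions U'"
      by simp_all
    then show "x = y"
      using eq border_eq_iff[OF car[of U v a] car[of U' v' a']] by (simp add: xy)
  qed
  ultimately have "rank_count TYPE('a) (Suc m) (Suc r) = card (SIGMA U:?I. ?F U)"
    by (simp add: rank_count_def card_image)
  also have "\<dots> = (\<Sum>U\<in>?I. card (?F U))"
    by (rule card_SigmaI) (auto intro: finite_subset[OF _ finite_extensions])
  finally have "int (rank_count TYPE('a) (Suc m) (Suc r)) = (\<Sum>U\<in>?I. int (card (?F U)))" by simp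
  also have "\<dots> = (\<Sum>U\<in>?I. (if vec_space.rank m U = Suc r then q ^ Suc r else 0)
      + (if vec_space.rank m U = r then q ^ (m - r) - q ^ r + kappa TYPE('a) (Suc m) else 0))"
    unfolding q_def by (rule sum.cong[OF refl]) (rule card_extensions_of_rank_Suc[OF odd])
  also have "\<dots> = int (rank_count TYPE('a) m (Suc r)) * q ^ Suc r
      + int (rank_count TYPE('a) m r) * (q ^ (m - r) - q ^ r + kappa TYPE('a) (Suc m))"
    by (simp add: sum.distrib rank_count_def flip: sum.inter_filter)
  finally show ?thesis by (simp add: algebra_simps)
qed

lemma rank_count_0: "rank_count TYPE('a :: {field, finite}) n 0 = 1"
proof -
  have "U = 0\<^sub>m n n" if U: "U \<in> carrier_mat n n" and "vec_space.rank n U = 0" for U :: "'a mat"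
  proof (rule eq_matI)
    have "card (mat_image U) = 1"
      using that(2) card_mat_image_eq_power_rank[OF U] by simp
    then obtain z where z: "mat_image U = {z}" by (rule card_1_singletonE)
    have image: "U *\<^sub>v y = z" if "y \<in> carrier_vec n" for y
      using that U z by (auto simp: mat_image_def)
    fix i j assume "i < dim_row (0\<^sub>m n n)" "j < dim_col (0\<^sub>m n n)"
    then have ij: "i < n" "j < n" by auto
    have "U $$ (i, j) = (U *\<^sub>v unit_vec n j) $ i" using U ij by simp
    also have "U *\<^sub>v unit_vec n j = U *\<^sub>v 0\<^sub>v n" using image by simp
    also have "(U *\<^sub>v 0\<^sub>v n) $ i = 0" using U ij by simp
    finally show "U $$ (i, j) = 0\<^sub>m n n $$ (i, j)" using ij by simp
  qed (use U in auto)
  then have "{U \<in> isotropic_upper TYPE('a) n. vec_space.rank n U = 0} = {0\<^sub>m n n}"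
    by (auto simp: isotropic_upper_def upper_triangular_def vec_space.rank_0I)
  then show ?thesis by (simp add: rank_count_def)
qed

theorem theorem6p7:
  fixes q n :: nat
  assumes "primepow q" and "odd q"
    and "CARD('a :: {field, finite}) = q"
  shows "rank_count TYPE('a) n 0 = 1 \<and>
    (\<forall>r. r > n div 2 \<longrightarrow> rank_count TYPE('a) n r = 0) \<and>
    (\<forall>r. 1 \<le> r \<and> r \<le> n div 2 \<longrightarrow>
       int (rank_count TYPE('a) n r) =
         int q ^ r * int (rank_count TYPE('a) (n - 1) r)
         + (int q ^ (n - r) - int q ^ (r - 1) + kappa TYPE('a) n)
             * int (rank_count TYPE('a) (n - 1) (r - 1))) \<and>
    (\<lambda>r. rank_count TYPE('a) n r) sums card (isotropic_upper TYPE('a) n)"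
proof (intro conjI allI impI)
  let ?I = "isotropic_upper TYPE('a) n"
  have rank_le: "vec_space.rank n U \<le> n div 2" if "U \<in> ?I" for U
    using that by (intro rank_isotropic_le) (auto simp: isotropic_upper_def)
  show "rank_count TYPE('a) n 0 = 1" by (rule rank_count_0)
  show zero: "rank_count TYPE('a) n r = 0" if "r > n div 2" for r
  proof -
    have "{U \<in> ?I. vec_space.rank n U = r} = {}" using rank_le that by fastforce
    then show ?thesis by (simp add: rank_count_def)
  qed
  show "int (rank_count TYPE('a) n r) =
      int q ^ r * int (rank_count TYPE('a) (n - 1) r)
      + (int q ^ (n - r) - int q ^ (r - 1) + kappa TYPE('a) n)
          * int (rank_count TYPE('a) (n - 1) (r - 1))"
    if "1 \<le> r \<and> r \<le> n div 2" for r
  proof -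
    obtain m r' where "n = Suc m" "r = Suc r'"
      using \<open>1 \<le> r \<and> r \<le> n div 2\<close> by (cases n; cases r) auto
    then show ?thesis
      using rank_count_Suc_Suc[where 'a='a] assms(2,3) by simp
  qed
  have "(\<Sum>r\<le>n div 2. rank_count TYPE('a) n r) = card ?I"
    using sum.group[of ?I "{..n div 2}" "vec_space.rank n" "\<lambda>_. 1 :: nat"] rank_le
    by (auto simp: rank_count_def)
  then show "(\<lambda>r. rank_count TYPE('a) n r) sums card ?I"
    using sums_finite[of "{..n div 2}" "\<lambda>r. rank_count TYPE('a) n r"] zero by simp
qed

end
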